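(* Let $\alpha\in(0,1)$ and let $c_{\alpha/2}$ satisfy $\Phi(c_{\alpha/2})=1-\alpha/2$. Let $T_i,T_j$ be jointly normal with zero means, unit variances and correlation $\rho_{ij}\in(-1,1)$. Let $R_i=\{|T_i|>c_{\alpha/2}\}$ and $R_j=\{|T_j|>c_{\alpha/2}\}$. Then: (a) $$\mathbb P(R_i\cap R_j)=4-8\Phi(c_{\alpha/2})+2\Phi_{\rho_{ij}}(c_{\alpha/2},c_{\alpha/2})+2\Phi_{-\rho_{ij}}(c_{\alpha/2},c_{\alpha/2})$$ $$=\alpha^2+2\left(\Phi_{\rho_{ij}}(c_{\alpha/2},c_{\alpha/2})+\Phi_{-\rho_{ij}}(c_{\alpha/2},c_{\alpha/2})-2\Phi(c_{\alpha/2})^2\right).$$ (b) $\mathbb P(R_i\cap R_j)$ is strictly increasing as a function of $\rho_{ij}$ on $(0,1)$. (c) If $\rho_{ij}>0$, then $\operatorname{Cov}(\mathbf 1_{R_i},\mathbf 1_{R_j})>0$.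
   Context: $\Phi$ is the CDF of the standard normal law, and $\Phi_\rho(x,y)$ is the CDF of the bivariate normal law with zero means, unit variances and correlation $\rho$. *)

theory Defs
  imports "HOL-Probability.Probability"
begin

abbreviation std_normal_cdf :: "real \<Rightarrow> real" where
  "std_normal_cdf \<equiv> cdf std_normal_distribution"

text \<open>The bivariate normal law with zero means, unit variances and correlation \<open>\<rho>\<close>, given by its
  Lebesgue density. It is meant for \<open>-1 < \<rho> < 1\<close> only.\<close>

definition std_bivariate_normal_density :: "real \<Rightarrow> real \<Rightarrow> real \<Rightarrow> real" where
  "std_bivariate_normal_density \<rho> x y =
     1 / (2 * pi * sqrt (1 - \<rho>\<^sup>2)) * exp (- (x\<^sup>2 - 2 * \<rho> * x * y + y\<^sup>2) / (2 * (1 - \<rho>\<^sup>2)))"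

definition std_bivariate_normal :: "real \<Rightarrow> (real \<times> real) measure" where
  "std_bivariate_normal \<rho> =
     density lborel (\<lambda>(x, y). ennreal (std_bivariate_normal_density \<rho> x y))"

definition std_bivariate_normal_cdf :: "real \<Rightarrow> real \<Rightarrow> real \<Rightarrow> real" where
  "std_bivariate_normal_cdf \<rho> x y = measure (std_bivariate_normal \<rho>) ({..x} \<times> {..y})"

text \<open>Joint normality (degenerate laws included): the pair has the law of an affine image of two
  independent standard normal variables. Means, variances and correlation are left arbitrary.\<close>

definition jointly_normal :: "'a measure \<Rightarrow> ('a \<Rightarrow> real) \<Rightarrow> ('a \<Rightarrow> real) \<Rightarrow> bool" where
  "jointly_normal M X Y \<longleftrightarrow>
     X \<in> borel_measurable M \<and> Y \<in> borel_measurable M \<and>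
     (\<exists>m1 m2 a11 a12 a21 a22 :: real.
        distr M borel (\<lambda>\<omega>. (X \<omega>, Y \<omega>)) =
        distr (std_normal_distribution \<Otimes>\<^sub>M std_normal_distribution) borel
          (\<lambda>(z1, z2). (m1 + a11 * z1 + a12 * z2, m2 + a21 * z1 + a22 * z2)))"

definition covariance :: "'a measure \<Rightarrow> ('a \<Rightarrow> real) \<Rightarrow> ('a \<Rightarrow> real) \<Rightarrow> real" where
  "covariance M X Y =
     prob_space.expectation M
       (\<lambda>\<omega>. (X \<omega> - prob_space.expectation M X) * (Y \<omega> - prob_space.expectation M Y))"

definition correlation :: "'a measure \<Rightarrow> ('a \<Rightarrow> real) \<Rightarrow> ('a \<Rightarrow> real) \<Rightarrow> real" where
  "correlation M X Y =
     covariance M X Y / sqrt (prob_space.variance M X * prob_space.variance M Y)"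

definition rejection :: "'a measure \<Rightarrow> ('a \<Rightarrow> real) \<Rightarrow> real \<Rightarrow> 'a set" where
  "rejection M T c = {\<omega> \<in> space M. \<bar>T \<omega>\<bar> > c}"

text \<open>The probability of joint rejection as a function of the correlation \<open>\<rho>\<close>: it is taken on the
  canonical model, i.e. for the two coordinates under the bivariate normal law.\<close>

definition joint_rejection_prob :: "real \<Rightarrow> real \<Rightarrow> real" where
  "joint_rejection_prob c \<rho> =
     measure (std_bivariate_normal \<rho>)
       (rejection (std_bivariate_normal \<rho>) fst c \<inter> rejection (std_bivariate_normal \<rho>) snd c)"

end

theory Submission
  imports Defs
begin

text \<open>
  The bivariate normal law with correlation \<open>\<rho>\<close> is the image of two independent standard normal
  variables under any linear map whose rows are unit vectors with inner product \<open>\<rho>\<close>. Hence swapping the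
  coordinates preserves the law and flipping one sign turns \<open>\<rho>\<close> into \<open>- \<rho>\<close>. The four corners of
  the joint rejection region thus reduce to upper right corners for \<open>\<rho>\<close> and \<open>- \<rho>\<close>, which gives (a).

  For (b), the joint rejection probability depends on \<open>\<rho>\<close> only through the probability of the square
  \<open>[-c, c]\<^sup>2\<close>. With \<open>s = sqrt (1 - \<rho>\<^sup>2)\<close>, conditioning on the first coordinate and differentiating
  under the integral leaves an integrand with an elementary antiderivative, by completing the
  square; the derivative is
  \<open>2 \<phi>(c) / s * (\<phi>(c (1 - \<rho>) / s) - \<phi>(c (1 + \<rho>) / s)) > 0\<close>
  on \<open>(0, 1)\<close>. Monotonicity extends to \<open>\<rho> = 0\<close>, where the two events are
  independent, and this is (c).
\<close>

declare borel_Times [simp]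

section \<open>Moments of two independent standard normal variables\<close>

abbreviation std_normal_pair :: "(real \<times> real) measure" where
  "std_normal_pair \<equiv> std_normal_distribution \<Otimes>\<^sub>M std_normal_distribution"

lemma integrable_std_normal_distribution_power:
  "integrable std_normal_distribution (\<lambda>x. x ^ k)"
  using integrable_std_normal_moment[of k] by (simp add: integrable_density)

lemma integral_std_normal_distribution_id: "integral\<^sup>L std_normal_distribution (\<lambda>x. x) = 0"
  using integral_std_normal_moment_odd[of 0] by (simp add: integral_density)

lemma integral_std_normal_distribution_square:
  "integral\<^sup>L std_normal_distribution (\<lambda>x. x\<^sup>2) = 1"
  using integral_std_normal_moment_even[of 1] by (simp add: integral_density fact_numeral)

lemma (in pair_sigma_finite)
  fixes f :: "'a \<Rightarrow> real" and g :: "'b \<Rightarrow> real"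
  assumes f: "integrable M1 f" and g: "integrable M2 g"
  shows integrable_mult_fst_snd: "integrable (M1 \<Otimes>\<^sub>M M2) (\<lambda>z. f (fst z) * g (snd z))"
    and integral_mult_fst_snd:
      "(\<integral>z. f (fst z) * g (snd z) \<partial>(M1 \<Otimes>\<^sub>M M2)) = integral\<^sup>L M1 f * integral\<^sup>L M2 g"
proof -
  have [measurable]: "f \<in> borel_measurable M1" "g \<in> borel_measurable M2"
    using f g by auto
  show *: "integrable (M1 \<Otimes>\<^sub>M M2) (\<lambda>z. f (fst z) * g (snd z))"
    using f g by (intro Fubini_integrable) (auto simp: abs_mult)
  then show "(\<integral>z. f (fst z) * g (snd z) \<partial>(M1 \<Otimes>\<^sub>M M2)) = integral\<^sup>L M1 f * integral\<^sup>L M2 g"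
    by (subst integral_fst'[symmetric]) auto
qed

lemma std_normal_pair_prob_space: "prob_space std_normal_pair"
proof -
  interpret N: prob_space std_normal_distribution
    by (rule prob_space_normal_density) simp
  interpret pair_prob_space std_normal_distribution std_normal_distribution ..
  show ?thesis by unfold_locales
qed

lemma
  shows integrable_std_normal_pair_monomial:
    "integrable std_normal_pair (\<lambda>z. fst z ^ j * snd z ^ k)"
  and integral_std_normal_pair_monomial:
    "(\<integral>z. fst z ^ j * snd z ^ k \<partial>std_normal_pair)
      = (\<integral>x. x ^ j \<partial>std_normal_distribution) * (\<integral>x. x ^ k \<partial>std_normal_distribution)"
proof -
  interpret N: prob_space std_normal_distribution
    by (rule prob_space_normal_density) simp
  interpret pair_sigma_finite std_normal_distribution std_normal_distribution ..
  show "integrable std_normal_pair (\<lambda>z. fst z ^ j * snd z ^ k)"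
    by (intro integrable_mult_fst_snd integrable_std_normal_distribution_power)
  show "(\<integral>z. fst z ^ j * snd z ^ k \<partial>std_normal_pair)
      = (\<integral>x. x ^ j \<partial>std_normal_distribution) * (\<integral>x. x ^ k \<partial>std_normal_distribution)"
    by (intro integral_mult_fst_snd integrable_std_normal_distribution_power)
qed

lemma integral_std_normal_pair_affine:
  "(\<integral>z. m + a * fst z + b * snd z \<partial>std_normal_pair) = m"
proof -
  interpret prob_space std_normal_pair by (rule std_normal_pair_prob_space)
  interpret N: prob_space std_normal_distribution
    by (rule prob_space_normal_density) simp
  note i = integrable_std_normal_pair_monomial[of 1 0] integrable_std_normal_pair_monomial[of 0 1]
    and v = integral_std_normal_pair_monomial[of 1 0] integral_std_normal_pair_monomial[of 0 1]
  show ?thesis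
    using i v by (simp add: integral_std_normal_distribution_id prob_space)
qed

text \<open>The second moments of a linear image are the inner products of its coefficient rows.
  This turns conditions on variances and correlation into unit length and inner product \<rho> of
  those rows.\<close>

lemma integral_std_normal_pair_bilinear:
  "(\<integral>z. (a * fst z + b * snd z) * (c * fst z + d * snd z) \<partial>std_normal_pair) = a * c + b * d"
proof -
  interpret N: prob_space std_normal_distribution
    by (rule prob_space_normal_density) simp
  \<comment> \<open>Exponents 0 and 1 are spelled out so that every summand is a monomial of the
    previous lemma. The mixed one contributes nothing, since the first moments vanish.\<close>
  have eq: "(\<lambda>z::real\<times>real. (a * fst z + b * snd z) * (c * fst z + d * snd z))
    = (\<lambda>z. (a * c) * (fst z ^ 2 * snd z ^ 0) + (a * d + b * c) * (fst z ^ 1 * snd z ^ 1)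
         + (b * d) * (fst z ^ 0 * snd z ^ 2))"
    by (auto simp: fun_eq_iff algebra_simps power2_eq_square)
  show ?thesis
    unfolding eq using N.prob_space
    by (simp only: integrable_std_normal_pair_monomial integral_std_normal_pair_monomial
        Bochner_Integration.integral_add Bochner_Integration.integrable_add
        integrable_mult_right integral_mult_right_zero)
      (simp add: integral_std_normal_distribution_id integral_std_normal_distribution_square)
qed

section \<open>The bivariate normal law as a linear image\<close>

text \<open>For \<open>a \<noteq> 0\<close> the linear map splits into two one-dimensional affine
  substitutions, one per coordinate, with Tonelli in between. Their scale factors multiply to the
  determinant.\<close>

lemma nn_integral_lborel_linear_pair:
  fixes f :: "real \<times> real \<Rightarrow> ennreal" and a b c d :: real
  assumes f[measurable]: "f \<in> borel_measurable borel" and det: "a * d - b * c \<noteq> 0"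
  shows "(\<integral>\<^sup>+x. \<integral>\<^sup>+y. f (x, y) \<partial>lborel \<partial>lborel)
    = ennreal \<bar>a * d - b * c\<bar> * (\<integral>\<^sup>+u. \<integral>\<^sup>+v. f (a * u + b * v, c * u + d * v) \<partial>lborel \<partial>lborel)"
proof -
  have *: "(\<integral>\<^sup>+x. \<integral>\<^sup>+y. f (x, y) \<partial>lborel \<partial>lborel)
    = ennreal \<bar>a * d - b * c\<bar> * (\<integral>\<^sup>+v. \<integral>\<^sup>+u. f (a * u + b * v, c * u + d * v) \<partial>lborel \<partial>lborel)"
    if a: "a \<noteq> 0" and det: "a * d - b * c \<noteq> 0" for a b c d :: real
  proof -
    \<comment> \<open>Eliminating \<open>u\<close> from \<open>x = a * u + b * v\<close> turns
      \<open>c * u + d * v\<close> into \<open>c / a * x + ?e * v\<close>, so \<open>?e\<close> is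
      the scale of \<open>v\<close> at fixed \<open>x\<close>.\<close>
    let ?e = "(a * d - b * c) / a"
    have e: "?e \<noteq> 0" using a det by simp
    have "(\<integral>\<^sup>+x. \<integral>\<^sup>+y. f (x, y) \<partial>lborel \<partial>lborel)
      = (\<integral>\<^sup>+x. ennreal \<bar>?e\<bar> * (\<integral>\<^sup>+v. f (x, c / a * x + ?e * v) \<partial>lborel) \<partial>lborel)"
      by (intro nn_integral_cong nn_integral_real_affine e) measurable
    also have "\<dots> = ennreal \<bar>?e\<bar> * (\<integral>\<^sup>+x. (\<integral>\<^sup>+v. f (x, c / a * x + ?e * v) \<partial>lborel) \<partial>lborel)"
      by (rule nn_integral_cmult) measurable
    also have "\<dots> = ennreal \<bar>?e\<bar> * (\<integral>\<^sup>+v. (\<integral>\<^sup>+x. f (x, c / a * x + ?e * v) \<partial>lborel) \<partial>lborel)"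
      by (subst lborel_pair.Fubini') (simp_all add: case_prod_beta)
    also have "(\<integral>\<^sup>+v. (\<integral>\<^sup>+x. f (x, c / a * x + ?e * v) \<partial>lborel) \<partial>lborel)
      = (\<integral>\<^sup>+v. ennreal \<bar>a\<bar> * (\<integral>\<^sup>+u. f (b * v + a * u, c / a * (b * v + a * u) + ?e * v) \<partial>lborel) \<partial>lborel)"
      by (intro nn_integral_cong nn_integral_real_affine a) measurable
    also have "\<dots> = (\<integral>\<^sup>+v. ennreal \<bar>a\<bar> * (\<integral>\<^sup>+u. f (a * u + b * v, c * u + d * v) \<partial>lborel) \<partial>lborel)"
      using a by (intro nn_integral_cong arg_cong2[where f="(*)"] refl arg_cong[where f=f])
        (auto simp: field_simps)
    also have "\<dots> = ennreal \<bar>a\<bar> * (\<integral>\<^sup>+v. (\<integral>\<^sup>+u. f (a * u + b * v, c * u + d * v) \<partial>lborel) \<partial>lborel)"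
      by (rule nn_integral_cmult) measurable
    finally show ?thesis
      using a by (simp add: mult.assoc[symmetric] ennreal_mult[symmetric] abs_divide)
  qed
  show ?thesis
  proof (cases "a = 0")
    case False
    show ?thesis
      by (subst *[OF False det], subst lborel_pair.Fubini') (simp_all add: case_prod_beta)
  next
    case True
    \<comment> \<open>Swapping the columns of the matrix, i.e. the names of \<open>u\<close> and
      \<open>v\<close>, puts \<open>b\<close> in the place of \<open>a\<close>; the order of
      integration then already agrees.\<close>
    then have "b \<noteq> 0" using det by auto
    moreover have "b * c - a * d \<noteq> 0" using det by simp
    ultimately show ?thesis
      using *[of b c a d] by (simp add: add.commute abs_minus_commute)
  qed
qed

lemma std_bivariate_normal_density_nonneg: "0 \<le> std_bivariate_normal_density \<rho> x y" if "\<bar>\<rho>\<bar> < 1"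
  using that by (simp add: std_bivariate_normal_density_def abs_square_le_1)

text \<open>Unit rows with inner product \<rho> pull the quadratic form in the exponent back to
  \<open>(1 - \<rho>\<^sup>2) * (u\<^sup>2 + v\<^sup>2)\<close>, and the determinant, of absolute
  value \<open>sqrt (1 - \<rho>\<^sup>2)\<close>, cancels the normalising constant.\<close>

lemma std_bivariate_normal_density_linear:
  fixes a b c d :: real
  assumes "a\<^sup>2 + b\<^sup>2 = 1" "c\<^sup>2 + d\<^sup>2 = 1" "a * c + b * d = \<rho>" "\<bar>\<rho>\<bar> < 1"
  shows "\<bar>a * d - b * c\<bar> * std_bivariate_normal_density \<rho> (a * u + b * v) (c * u + d * v)
    = std_normal_density u * std_normal_density v"
proof -
  have det: "(a * d - b * c)\<^sup>2 = 1 - \<rho>\<^sup>2"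
  proof -
    \<comment> \<open>Lagrange's identity: the squared determinant is the Gram determinant of the
      rows.\<close>
    have "(a * d - b * c)\<^sup>2 = (a\<^sup>2 + b\<^sup>2) * (c\<^sup>2 + d\<^sup>2) - (a * c + b * d)\<^sup>2"
      by (simp add: power2_eq_square algebra_simps)
    then show ?thesis using assms by simp
  qed
  then have s: "sqrt (1 - \<rho>\<^sup>2) = \<bar>a * d - b * c\<bar>"
    by (metis real_sqrt_abs)
  have pos: "1 - \<rho>\<^sup>2 > 0" using assms(4) by (simp add: abs_square_less_1)
  have quad: "(a * u + b * v)\<^sup>2 - 2 * \<rho> * (a * u + b * v) * (c * u + d * v) + (c * u + d * v)\<^sup>2
    = (1 - \<rho>\<^sup>2) * (u\<^sup>2 + v\<^sup>2)"
  proof -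
    have 1: "d\<^sup>2 = 1 - c\<^sup>2" "b\<^sup>2 = 1 - a\<^sup>2" using assms by auto
    show ?thesis
      using 1 assms(3) by algebra
  qed
  have "\<bar>a * d - b * c\<bar> > 0" using pos det by auto
  then show ?thesis
    unfolding std_bivariate_normal_density_def s quad std_normal_density_def
    using pos by (simp add: mult_exp_exp field_simps)
qed

lemma sets_std_normal_pair: "sets std_normal_pair = sets (borel :: (real \<times> real) measure)"
  by (simp add: borel_prod[symmetric] cong: sets_pair_measure_cong)

text \<open>Change of variables in the density. Allowing every matrix with the right Gram matrix,
  and not one fixed root, is what later yields the symmetries of the law without further
  integration.\<close>

lemma std_bivariate_normal_eq_distr:
  fixes a b c d :: real
  assumes ab: "a\<^sup>2 + b\<^sup>2 = 1" and cd: "c\<^sup>2 + d\<^sup>2 = 1" and \<rho>: "a * c + b * d = \<rho>" "\<bar>\<rho>\<bar> < 1"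
  shows "std_bivariate_normal \<rho>
    = distr std_normal_pair borel (\<lambda>z. (a * fst z + b * snd z, c * fst z + d * snd z))"
proof (rule measure_eqI)
  have meas: "(\<lambda>z. (a * fst z + b * snd z, c * fst z + d * snd z)) \<in> std_normal_pair \<rightarrow>\<^sub>M borel"
    by (intro borel_measurable_Pair) measurable
  fix A assume "A \<in> sets (std_bivariate_normal \<rho>)"
  then have A[measurable]: "A \<in> sets borel" by (simp add: std_bivariate_normal_def)
  have det: "a * d - b * c \<noteq> 0"
  proof
    assume "a * d - b * c = 0"
    moreover have "(a * d - b * c)\<^sup>2 = (a\<^sup>2 + b\<^sup>2) * (c\<^sup>2 + d\<^sup>2) - (a * c + b * d)\<^sup>2"
      by (simp add: power2_eq_square algebra_simps)
    ultimately show False using assms by (simp add: abs_square_eq_1)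
  qed
  have dens[measurable]: "(\<lambda>z. std_bivariate_normal_density \<rho> (fst z) (snd z)) \<in> borel_measurable borel"
    unfolding std_bivariate_normal_density_def using \<rho>(2)
    by (intro borel_measurable_continuous_onI continuous_intros) (auto simp: abs_square_eq_1)
  define I :: "real \<times> real \<Rightarrow> ennreal" where "I = indicator A"
  define f where "f = (\<lambda>z. ennreal (std_bivariate_normal_density \<rho> (fst z) (snd z)) * I z)"
  have [measurable]: "I \<in> borel_measurable borel" unfolding I_def by measurable
  have [measurable]: "f \<in> borel_measurable borel" unfolding f_def by measurable
  have "emeasure (std_bivariate_normal \<rho>) A = (\<integral>\<^sup>+z. f z \<partial>lborel)"
    unfolding std_bivariate_normal_def f_def I_def
    by (subst emeasure_density) (auto simp: case_prod_beta)
  also have "\<dots> = (\<integral>\<^sup>+z. f z \<partial>(lborel \<Otimes>\<^sub>M lborel))"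
    by (simp only: lborel_prod)
  also have "\<dots> = (\<integral>\<^sup>+x. \<integral>\<^sup>+y. f (x, y) \<partial>lborel \<partial>lborel)"
    by (rule lborel.nn_integral_fst[symmetric]) (simp add: lborel_prod)
  also have "\<dots> = ennreal \<bar>a * d - b * c\<bar>
      * (\<integral>\<^sup>+u. \<integral>\<^sup>+v. f (a * u + b * v, c * u + d * v) \<partial>lborel \<partial>lborel)"
    by (rule nn_integral_lborel_linear_pair[OF _ det]) measurable
  also have "\<dots> = (\<integral>\<^sup>+u. \<integral>\<^sup>+v. ennreal \<bar>a * d - b * c\<bar> * f (a * u + b * v, c * u + d * v) \<partial>lborel \<partial>lborel)"
    by (simp add: nn_integral_cmult)
  also have "\<dots> = (\<integral>\<^sup>+u. \<integral>\<^sup>+v. ennreal (std_normal_density u) * (ennreal (std_normal_density v)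
      * I (a * u + b * v, c * u + d * v)) \<partial>lborel \<partial>lborel)"
    using std_bivariate_normal_density_linear[OF ab cd \<rho>] std_bivariate_normal_density_nonneg[OF \<rho>(2)]
    by (intro nn_integral_cong) (simp add: f_def ennreal_mult'[symmetric] mult.assoc[symmetric])
  also have "\<dots> = (\<integral>\<^sup>+u. \<integral>\<^sup>+v. I (a * u + b * v, c * u + d * v)
      \<partial>std_normal_distribution \<partial>std_normal_distribution)"
    by (simp add: nn_integral_cmult nn_integral_density)
  also have "\<dots> = (\<integral>\<^sup>+z. I (a * fst z + b * snd z, c * fst z + d * snd z) \<partial>std_normal_pair)"
  proof -
    interpret N: prob_space std_normal_distribution
      by (rule prob_space_normal_density) simp
    show ?thesis
      by (subst N.nn_integral_fst[symmetric]) simp_all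
  qed
  also have "\<dots> = (\<integral>\<^sup>+z. I z \<partial>distr std_normal_pair borel (\<lambda>z. (a * fst z + b * snd z, c * fst z + d * snd z)))"
    by (rule nn_integral_distr[OF meas, symmetric]) measurable
  also have "\<dots> = emeasure (distr std_normal_pair borel (\<lambda>z. (a * fst z + b * snd z, c * fst z + d * snd z))) A"
    unfolding I_def by simp
  finally show "emeasure (std_bivariate_normal \<rho>) A
    = emeasure (distr std_normal_pair borel (\<lambda>z. (a * fst z + b * snd z, c * fst z + d * snd z))) A" .
qed (simp add: std_bivariate_normal_def)

section \<open>Calculus of the standard normal density and distribution function\<close>

lemma continuous_on_std_normal_density: "continuous_on A std_normal_density"
  unfolding std_normal_density_def by (intro continuous_intros) auto

lemma std_normal_density_has_real_derivative:
  "(std_normal_density has_real_derivative - x * std_normal_density x) (at x)"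
  unfolding std_normal_density_def
  by (rule derivative_eq_intros refl | simp)+

lemma std_normal_density_minus [simp]: "std_normal_density (- x) = std_normal_density x"
  by (simp add: std_normal_density_def)

lemma measure_std_normal_distribution_Icc:
  "measure std_normal_distribution {a..b} = integral {a..b} std_normal_density"
proof -
  have "measure std_normal_distribution {a..b} = (\<integral>x. indicator {a..b} x \<partial>std_normal_distribution)"
    by simp
  also have "\<dots> = (LINT x:{a..b}|lborel. std_normal_density x)"
    by (subst integral_density) (auto simp: set_lebesgue_integral_def mult.commute)
  also have "\<dots> = integral {a..b} std_normal_density"
    by (rule set_borel_integral_eq_integral)
      (auto intro!: borel_integrable_atLeastAtMost' continuous_on_std_normal_density)
  finally show ?thesis .
qed

lemma measure_std_normal_distribution_singleton: "measure std_normal_distribution {x} = 0"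
  using measure_std_normal_distribution_Icc[of x x] by simp

lemma std_normal_cdf_diff:
  assumes "a \<le> b"
  shows "std_normal_cdf b - std_normal_cdf a = integral {a..b} std_normal_density"
    and "std_normal_cdf b - std_normal_cdf a = measure std_normal_distribution {a..b}"
proof -
  interpret real_distribution std_normal_distribution by (rule real_dist_normal_dist)
  \<comment> \<open>The half-open interval is the closed one minus an endpoint of measure 0.\<close>
  have "measure std_normal_distribution {..b}
     = measure std_normal_distribution ({..a} \<union> ({a..b} - {a}))"
    using assms by (intro arg_cong[where f="measure _"]) auto
  also have "\<dots> = measure std_normal_distribution {..a} + measure std_normal_distribution ({a..b} - {a})"
    by (rule finite_measure_Union) auto
  also have "measure std_normal_distribution ({a..b} - {a}) = measure std_normal_distribution {a..b}"
    using assms by (subst finite_measure_Diff) (auto simp: measure_std_normal_distribution_singleton)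
  finally show *: "std_normal_cdf b - std_normal_cdf a = measure std_normal_distribution {a..b}"
    by (simp add: cdf_def)
  then show "std_normal_cdf b - std_normal_cdf a = integral {a..b} std_normal_density"
    by (simp add: measure_std_normal_distribution_Icc)
qed

lemma std_normal_cdf_has_real_derivative [derivative_intros]:
  assumes "(g has_real_derivative g') (at x within S)"
  shows "((\<lambda>x. std_normal_cdf (g x)) has_real_derivative std_normal_density (g x) * g') (at x within S)"
proof -
  have "(std_normal_cdf has_real_derivative std_normal_density x) (at x)" for x
  proof -
    \<comment> \<open>On the window from \<open>x - 1\<close> to \<open>x + 1\<close> the CDF is a
      constant plus an integral of a continuous density. Since \<open>x\<close> is interior, the
      derivative within the window is the full derivative.\<close>
    have "((\<lambda>y. std_normal_cdf (x - 1) + integral {x - 1..y} std_normal_density)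
        has_real_derivative std_normal_density x) (at x within {x - 1..x + 1})"
      by (auto intro!: derivative_eq_intros integral_has_real_derivative
          continuous_on_std_normal_density)
    then have "(std_normal_cdf has_real_derivative std_normal_density x) (at x within {x - 1..x + 1})"
      by (rule has_field_derivative_transform_within[where d=1])
        (auto simp: std_normal_cdf_diff(1)[symmetric])
    then show ?thesis
      by (simp add: at_within_Icc_at)
  qed
  from DERIV_chain2[OF this assms] show ?thesis .
qed

lemma continuous_on_std_normal_cdf [continuous_intros]:
  "continuous_on A g \<Longrightarrow> continuous_on A (\<lambda>x. std_normal_cdf (g x))"
  by (rule continuous_on_compose2[of UNIV std_normal_cdf])
    (auto intro!: DERIV_continuous_on[where D=std_normal_density] derivative_eq_intros)

section \<open>The strip probability and its derivative in the correlation\<close>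

text \<open>Divided by \<open>sqrt (1 - \<rho>\<^sup>2)\<close>, both sides are the bivariate
  density at \<open>(x, a)\<close>, factored by conditioning on one coordinate or on the other. On
  the right \<open>x\<close> occurs in one Gaussian factor only, which makes the integral over
  \<open>x\<close> elementary.\<close>

lemma std_normal_density_complete_square:
  assumes "\<bar>\<rho>\<bar> < 1"
  shows "std_normal_density x * std_normal_density ((a - \<rho> * x) / sqrt (1 - \<rho>\<^sup>2))
    = std_normal_density a * std_normal_density ((x - \<rho> * a) / sqrt (1 - \<rho>\<^sup>2))"
proof -
  have s: "1 - \<rho>\<^sup>2 > 0" using assms by (simp add: abs_square_less_1)
  have "x\<^sup>2 + (a - \<rho> * x)\<^sup>2 / (1 - \<rho>\<^sup>2) = a\<^sup>2 + (x - \<rho> * a)\<^sup>2 / (1 - \<rho>\<^sup>2)"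
    using s by (simp add: field_simps power2_eq_square)
  moreover have "- p / 2 + - q / 2 = - u / 2 + - v / 2" if "p + q = u + v" for p q u v :: real
    using that by (simp add: field_simps)
  ultimately have "- x\<^sup>2 / 2 + - ((a - \<rho> * x)\<^sup>2 / (1 - \<rho>\<^sup>2)) / 2 = - a\<^sup>2 / 2 + - ((x - \<rho> * a)\<^sup>2 / (1 - \<rho>\<^sup>2)) / 2"
    by blast
  then show ?thesis
    using s by (simp add: std_normal_density_def mult_exp_exp power_divide)
qed

text \<open>For independent standard normal \<open>Z\<close>, \<open>W\<close> this is the probability that \<open>\<bar>Z\<bar> \<le> c\<close> and
  \<open>\<rho> Z + sqrt (1 - \<rho>\<^sup>2) W \<le> a\<close>.\<close>

definition std_normal_strip_prob :: "real \<Rightarrow> real \<Rightarrow> real \<Rightarrow> real" where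
  "std_normal_strip_prob c a \<rho> =
    integral {-c..c} (\<lambda>x. std_normal_density x * std_normal_cdf ((a - \<rho> * x) / sqrt (1 - \<rho>\<^sup>2)))"

lemma std_normal_strip_prob_has_real_derivative:
  assumes \<rho>: "\<bar>\<rho>\<bar> < 1" and c: "0 \<le> c"
  shows "(std_normal_strip_prob c a has_real_derivative
      std_normal_density a / sqrt (1 - \<rho>\<^sup>2)
      * (std_normal_density ((c - \<rho> * a) / sqrt (1 - \<rho>\<^sup>2))
        - std_normal_density ((c + \<rho> * a) / sqrt (1 - \<rho>\<^sup>2)))) (at \<rho>)"
proof -
  \<comment> \<open>Convex, as the Leibniz rule demands, and open, so that derivatives within it are
    full derivatives; the square root is positive throughout.\<close>
  let ?U = "{-1<..<1::real}"
  define s :: "real \<Rightarrow> real" where "s r = sqrt (1 - r\<^sup>2)" for r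
  have s_pos: "s r > 0" and s_sq: "(s r)\<^sup>2 = 1 - r\<^sup>2" if "r \<in> ?U" for r
    using that by (auto simp: s_def abs_square_less_1 abs_square_le_1 less_imp_le)
  define K where "K r x = std_normal_density x * (std_normal_density ((a - r * x) / s r)
      * ((r * a - x) / s r ^ 3))" for r x
  have cont_s: "continuous_on A s" for A
    unfolding s_def by (intro continuous_intros)
  have U: "\<rho> \<in> ?U" using \<rho> by auto
  have "((\<lambda>r. integral (cbox (-c) c) (\<lambda>x. std_normal_density x * std_normal_cdf ((a - r * x) / s r)))
      has_field_derivative integral (cbox (-c) c) (K \<rho>)) (at \<rho> within ?U)"
  proof (rule leibniz_rule_field_derivative)
    fix r x :: real assume r: "r \<in> ?U" and "x \<in> cbox (-c) c"
    have s': "(s has_real_derivative - r / s r) (at r within ?U)"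
      unfolding s_def using s_pos[OF r] unfolding s_def
      by (auto intro!: derivative_eq_intros simp: field_simps)
    \<comment> \<open>The quotient rule for the argument of the CDF, simplified by
      \<open>(s r)\<^sup>2 = 1 - r\<^sup>2\<close>.\<close>
    have "(- x * s r - (a - r * x) * (- r / s r)) / (s r * s r) = (r * a - x) / s r ^ 3"
      using s_pos[OF r] s_sq[OF r] by (simp add: field_simps) algebra
    then show "((\<lambda>r. std_normal_density x * std_normal_cdf ((a - r * x) / s r))
        has_real_derivative K r x) (at r within ?U)"
      unfolding K_def using s_pos[OF r]
      by (auto intro!: derivative_eq_intros s')
  next
    fix r assume r: "r \<in> ?U"
    show "(\<lambda>x. std_normal_density x * std_normal_cdf ((a - r * x) / s r)) integrable_on cbox (-c) c"
      using s_pos[OF r] by (intro integrable_continuous continuous_intros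
          continuous_on_std_normal_density) auto
  next
    show "continuous_on (?U \<times> cbox (-c) c) (\<lambda>(r, x). K r x)"
      unfolding K_def std_normal_density_def split_beta using s_pos
      by (intro continuous_intros continuous_on_compose2[OF cont_s[of UNIV]]) fastforce+
  qed (use U in auto)
  then have "(std_normal_strip_prob c a has_real_derivative integral {-c..c} (K \<rho>)) (at \<rho>)"
    using U by (simp add: std_normal_strip_prob_def[abs_def] s_def at_within_open[of \<rho> ?U])
  \<comment> \<open>After completing the square,
    \<open>std_normal_density' y = - y * std_normal_density y\<close> identifies
    \<open>K \<rho>\<close> as the derivative of \<open>std_normal_density a / s \<rho> *
    std_normal_density ((x - \<rho> * a) / s \<rho>)\<close>.\<close>
  moreover have "(K \<rho> has_integral
      (std_normal_density a / s \<rho> * std_normal_density ((c - \<rho> * a) / s \<rho>)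
       - std_normal_density a / s \<rho> * std_normal_density ((- c - \<rho> * a) / s \<rho>))) {-c..c}"
  proof (rule fundamental_theorem_of_calculus)
    fix x assume "x \<in> {-c..c}"
    have "K \<rho> x = std_normal_density a * std_normal_density ((x - \<rho> * a) / s \<rho>) * ((\<rho> * a - x) / s \<rho> ^ 3)"
      unfolding K_def using std_normal_density_complete_square[OF \<rho>, of x a] by (simp add: s_def)
    then have K: "K \<rho> x = std_normal_density a / s \<rho>
        * (- ((x - \<rho> * a) / s \<rho>) * std_normal_density ((x - \<rho> * a) / s \<rho>) * (1 / s \<rho>))"
      using s_pos[OF U] by (simp add: field_simps power3_eq_cube)
    show "((\<lambda>x. std_normal_density a / s \<rho> * std_normal_density ((x - \<rho> * a) / s \<rho>))
        has_vector_derivative K \<rho> x) (at x within {-c..c})"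
      unfolding has_real_derivative_iff_has_vector_derivative[symmetric] K
      using s_pos[OF U]
      by (intro DERIV_cmult DERIV_chain2[OF std_normal_density_has_real_derivative])
        (auto intro!: derivative_eq_intros)
  qed (use c in auto)
  moreover have "std_normal_density ((- c - \<rho> * a) / s \<rho>) = std_normal_density ((c + \<rho> * a) / s \<rho>)"
    by (simp add: std_normal_density_def power_divide power2_eq_square algebra_simps)
  ultimately show ?thesis
    by (simp add: integral_unique right_diff_distrib s_def)
qed

text \<open>The derivatives for the levels \<open>c\<close> and \<open>- c\<close> are opposite, so
  the difference doubles. It is positive for \<open>r > 0\<close> because the density decreases in
  the absolute value of its argument. At \<open>r = 0\<close> it vanishes, hence a monotonicity
  criterion that asks for positivity only in the open interval.\<close>

lemma std_normal_strip_prob_diff_strict_mono: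
  assumes c: "0 < c" and "0 \<le> \<rho>" "\<rho> < \<rho>'" "\<rho>' < 1"
  shows "std_normal_strip_prob c c \<rho> - std_normal_strip_prob c (- c) \<rho>
    < std_normal_strip_prob c c \<rho>' - std_normal_strip_prob c (- c) \<rho>'"
proof (rule DERIV_pos_imp_increasing_open[OF assms(3)])
  define D where "D r = 2 * std_normal_density c / sqrt (1 - r\<^sup>2)
      * (std_normal_density (c * (1 - r) / sqrt (1 - r\<^sup>2))
        - std_normal_density (c * (1 + r) / sqrt (1 - r\<^sup>2)))" for r
  have D: "((\<lambda>r. std_normal_strip_prob c c r - std_normal_strip_prob c (- c) r)
      has_real_derivative D r) (at r)" if "0 \<le> r" "r < 1" for r
    using that c
    by (auto intro!: derivative_eq_intros std_normal_strip_prob_has_real_derivative)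
      (simp add: D_def algebra_simps diff_divide_distrib)
  show "continuous_on {\<rho>..\<rho>'} (\<lambda>r. std_normal_strip_prob c c r - std_normal_strip_prob c (- c) r)"
    using assms
    by (intro DERIV_continuous_on[where D=D] has_field_derivative_at_within[OF D]) auto
  fix r assume r: "\<rho> < r" "r < \<rho>'"
  have s: "sqrt (1 - r\<^sup>2) > 0"
    using r assms by (simp add: abs_square_less_1)
  have "c * (1 - r) / sqrt (1 - r\<^sup>2) < c * (1 + r) / sqrt (1 - r\<^sup>2)"
    using s r assms by (intro divide_strict_right_mono mult_strict_left_mono) auto
  moreover have "0 \<le> c * (1 - r) / sqrt (1 - r\<^sup>2)"
    using s r assms by auto
  ultimately have "(c * (1 - r) / sqrt (1 - r\<^sup>2))\<^sup>2 < (c * (1 + r) / sqrt (1 - r\<^sup>2))\<^sup>2"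
    by (intro power_strict_mono) auto
  then have "0 < D r"
    unfolding D_def using s
    by (intro mult_pos_pos divide_pos_pos) (auto simp: std_normal_density_def normal_density_pos divide_strict_right_mono)
  then show "\<exists>y. ((\<lambda>r. std_normal_strip_prob c c r - std_normal_strip_prob c (- c) r)
      has_real_derivative y) (at r) \<and> 0 < y"
    using D[of r] r assms by auto
qed

section \<open>Symmetries and marginals of the bivariate normal law\<close>

lemma space_std_bivariate_normal [simp]: "space (std_bivariate_normal \<rho>) = UNIV"
  and sets_std_bivariate_normal [simp, measurable_cong]: "sets (std_bivariate_normal \<rho>) = sets borel"
  by (simp_all add: std_bivariate_normal_def)

lemma borel_measurable_fst_snd [measurable]:
  "(fst :: real \<times> real \<Rightarrow> real) \<in> borel_measurable borel"
  "(snd :: real \<times> real \<Rightarrow> real) \<in> borel_measurable borel"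
  by (intro borel_measurable_continuous_onI continuous_intros)+

lemma borel_measurable_linear_pair [measurable]:
  "(\<lambda>z :: real \<times> real. (a * fst z + b * snd z, c * fst z + d * snd z)) \<in> borel \<rightarrow>\<^sub>M borel"
  by (intro borel_measurable_continuous_onI continuous_intros)

text \<open>The triangular choice of rows: the first coordinate is the first variable itself, so its
  marginal and the conditioning on it are immediate.\<close>

lemma std_bivariate_normal_eq_distr_canonical:
  assumes "\<bar>\<rho>\<bar> < 1"
  shows "std_bivariate_normal \<rho> = distr std_normal_pair borel
    (\<lambda>z. (1 * fst z + 0 * snd z, \<rho> * fst z + sqrt (1 - \<rho>\<^sup>2) * snd z))"
  using assms by (intro std_bivariate_normal_eq_distr) (auto simp: abs_square_le_1)

lemma prob_space_std_bivariate_normal: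
  assumes "\<bar>\<rho>\<bar> < 1"
  shows "prob_space (std_bivariate_normal \<rho>)"
proof -
  interpret prob_space std_normal_pair by (rule std_normal_pair_prob_space)
  show ?thesis
    unfolding std_bivariate_normal_eq_distr_canonical[OF assms]
    by (rule prob_space_distr)
      (use measurable_cong_sets[OF sets_std_normal_pair refl] borel_measurable_linear_pair in blast)
qed

text \<open>The three equations say that the new coordinates have unit variances and covariance
  \<open>\<rho>'\<close>. Composition with the triangular representation gives rows with exactly
  that Gram matrix.\<close>

lemma distr_std_bivariate_normal_linear:
  assumes \<rho>: "\<bar>\<rho>\<bar> < 1" "\<bar>\<rho>'\<bar> < 1"
    and "p\<^sup>2 + q\<^sup>2 + 2 * \<rho> * p * q = 1" "r\<^sup>2 + t\<^sup>2 + 2 * \<rho> * r * t = 1"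
    and "p * r + q * t + \<rho> * (p * t + q * r) = \<rho>'"
  shows "distr (std_bivariate_normal \<rho>) borel (\<lambda>z. (p * fst z + q * snd z, r * fst z + t * snd z))
    = std_bivariate_normal \<rho>'"
proof -
  let ?s = "sqrt (1 - \<rho>\<^sup>2)"
  have s: "?s\<^sup>2 = 1 - \<rho>\<^sup>2" using \<rho> by (simp add: abs_square_le_1)
  have "distr (std_bivariate_normal \<rho>) borel (\<lambda>z. (p * fst z + q * snd z, r * fst z + t * snd z))
    = distr std_normal_pair borel (\<lambda>z. ((p + q * \<rho>) * fst z + (q * ?s) * snd z, (r + t * \<rho>) * fst z + (t * ?s) * snd z))"
    unfolding std_bivariate_normal_eq_distr_canonical[OF \<rho>(1)]
    by (subst distr_distr)
      (auto simp: measurable_cong_sets[OF sets_std_normal_pair refl] o_def algebra_simps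
        intro!: distr_cong borel_measurable_continuous_onI continuous_intros)
  also have "\<dots> = std_bivariate_normal \<rho>'"
  proof (rule std_bivariate_normal_eq_distr[symmetric])
    show "(p + q * \<rho>)\<^sup>2 + (q * ?s)\<^sup>2 = 1" "(r + t * \<rho>)\<^sup>2 + (t * ?s)\<^sup>2 = 1"
      "(p + q * \<rho>) * (r + t * \<rho>) + q * ?s * (t * ?s) = \<rho>'"
      using assms s by algebra+
  qed fact
  finally show ?thesis .
qed

lemma measure_std_bivariate_normal_linear:
  assumes "\<bar>\<rho>\<bar> < 1" "\<bar>\<rho>'\<bar> < 1"
    and "p\<^sup>2 + q\<^sup>2 + 2 * \<rho> * p * q = 1" "r\<^sup>2 + t\<^sup>2 + 2 * \<rho> * r * t = 1"
    and "p * r + q * t + \<rho> * (p * t + q * r) = \<rho>'"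
    and A: "A \<in> sets borel"
  shows "measure (std_bivariate_normal \<rho>') A
    = measure (std_bivariate_normal \<rho>) {z. (p * fst z + q * snd z, r * fst z + t * snd z) \<in> A}"
  unfolding distr_std_bivariate_normal_linear[OF assms(1-5), symmetric]
  by (subst measure_distr[OF _ A]) (auto simp: vimage_def intro!: borel_measurable_continuous_onI continuous_intros)

lemma measure_std_bivariate_normal_fst:
  assumes \<rho>: "\<bar>\<rho>\<bar> < 1" and A: "A \<in> sets borel"
  shows "measure (std_bivariate_normal \<rho>) (A \<times> UNIV) = measure std_normal_distribution A"
proof -
  interpret N: prob_space std_normal_distribution
    by (rule prob_space_normal_density) simp
  have "measure (std_bivariate_normal \<rho>) (A \<times> UNIV) = measure std_normal_pair (A \<times> UNIV)"
    unfolding std_bivariate_normal_eq_distr_canonical[OF \<rho>] using A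
    by (subst measure_distr)
      (auto simp: measurable_cong_sets[OF sets_std_normal_pair refl] space_pair_measure
        intro!: arg_cong[where f="measure _"] borel_measurable_continuous_onI continuous_intros)
  also have "\<dots> = measure std_normal_distribution A"
    using A N.emeasure_pair_measure_Times[of A std_normal_distribution UNIV] N.emeasure_space_1
    by (simp add: measure_def)
  finally show ?thesis .
qed

lemma measure_std_bivariate_normal_snd:
  assumes \<rho>: "\<bar>\<rho>\<bar> < 1" and A: "A \<in> sets borel"
  shows "measure (std_bivariate_normal \<rho>) (UNIV \<times> A) = measure std_normal_distribution A"
proof -
  have "measure (std_bivariate_normal \<rho>) (UNIV \<times> A) = measure (std_bivariate_normal \<rho>) (A \<times> UNIV)"
    \<comment> \<open>The coefficients 0, 1, 1, 0 swap the coordinates.\<close>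
    using \<rho> A by (subst measure_std_bivariate_normal_linear[of \<rho> \<rho> 0 1 1 0])
      (auto intro!: arg_cong[where f="measure _"])
  then show ?thesis
    using measure_std_bivariate_normal_fst[OF assms] by simp
qed

text \<open>The reflection symmetry of one variable is read off from the first marginal at
  correlation 0, where flipping the sign of one coordinate preserves the law.\<close>

lemma std_normal_cdf_minus: "std_normal_cdf (- x) = 1 - std_normal_cdf x"
proof -
  interpret prob_space "std_bivariate_normal 0"
    by (rule prob_space_std_bivariate_normal) simp
  interpret N: real_distribution std_normal_distribution by (rule real_dist_normal_dist)
  have "std_normal_cdf (- x) = prob ({..- x} \<times> UNIV)"
    by (simp add: cdf_def measure_std_bivariate_normal_fst)
  also have "\<dots> = prob ({x..} \<times> UNIV)"
    by (subst measure_std_bivariate_normal_linear[of 0 0 "-1" 0 0 1])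
      (auto intro!: arg_cong[where f="measure _"] simp: borel_prod[symmetric])
  also have "\<dots> = N.prob {x..}"
    by (simp add: measure_std_bivariate_normal_fst)
  also have "\<dots> = 1 - N.prob {..<x}"
    by (subst N.prob_compl[symmetric]) (auto intro!: arg_cong[where f=N.prob])
  also have "N.prob {..<x} = N.prob ({..x} - {x})"
    by (auto intro!: arg_cong[where f=N.prob])
  also have "\<dots> = std_normal_cdf x"
    by (subst N.finite_measure_Diff) (auto simp: cdf_def measure_std_normal_distribution_singleton)
  finally show ?thesis .
qed

text \<open>This makes the critical value positive, since \<open>1 - \<alpha> / 2\<close> exceeds
  one half. For \<open>x \<le> 0\<close> the CDF at \<open>x\<close> would be at most its value at
  \<open>- x\<close>, although both sum to 1.\<close>

lemma std_normal_cdf_gt_half_imp_pos: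
  assumes "1 / 2 < std_normal_cdf x"
  shows "0 < x"
proof (rule ccontr)
  interpret real_distribution std_normal_distribution by (rule real_dist_normal_dist)
  assume "\<not> 0 < x"
  then have "std_normal_cdf x \<le> std_normal_cdf (- x)"
    by (intro cdf_nondecreasing) simp
  then show False
    using assms std_normal_cdf_minus[of x] by simp
qed

section \<open>The joint rejection probability: corners, square, monotonicity\<close>

lemma rejection_std_bivariate_normal:
  "rejection (std_bivariate_normal \<rho>) fst c = {z. c < \<bar>fst z\<bar>}"
  "rejection (std_bivariate_normal \<rho>) snd c = {z. c < \<bar>snd z\<bar>}"
  by (simp_all add: rejection_def)

lemma joint_rejection_prob_eq_cdf:
  assumes \<rho>: "\<bar>\<rho>\<bar> < 1" and c: "0 \<le> c"
  shows "joint_rejection_prob c \<rho> = 4 - 8 * std_normal_cdf c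
    + 2 * std_bivariate_normal_cdf \<rho> c c + 2 * std_bivariate_normal_cdf (- \<rho>) c c"
proof -
  \<comment> \<open>Inclusion-exclusion on the complement of the corner, for general
    \<open>r\<close> because both \<rho> and its negative are needed.\<close>
  have upper: "measure (std_bivariate_normal r) ({c<..} \<times> {c<..})
    = 1 - 2 * std_normal_cdf c + std_bivariate_normal_cdf r c c" if r: "\<bar>r\<bar> < 1" for r
  proof -
    interpret prob_space "std_bivariate_normal r"
      by (rule prob_space_std_bivariate_normal[OF r])
    have "{c<..} \<times> {c<..} = UNIV - ({..c} \<times> UNIV \<union> UNIV \<times> {..c})" by auto
    then have "prob ({c<..} \<times> {c<..}) = 1 - prob ({..c} \<times> UNIV \<union> UNIV \<times> {..c})"
      using prob_compl[of "{..c} \<times> UNIV \<union> UNIV \<times> {..c}"] by (simp add: sets.Un)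
    also have "prob ({..c} \<times> UNIV \<union> UNIV \<times> {..c})
      = prob ({..c} \<times> UNIV) + prob (UNIV \<times> {..c}) - prob (({..c} \<times> UNIV) \<inter> (UNIV \<times> {..c}))"
      by (rule measure_Un3) (auto simp: fmeasurable_eq_sets)
    also have "({..c} \<times> UNIV) \<inter> (UNIV \<times> {..c}) = {..c} \<times> {..c}" by auto
    finally show ?thesis
      using r by (simp add: measure_std_bivariate_normal_fst measure_std_bivariate_normal_snd cdf_def
          std_bivariate_normal_cdf_def)
  qed
  interpret prob_space "std_bivariate_normal \<rho>"
    by (rule prob_space_std_bivariate_normal[OF \<rho>])
  let ?P = "{c<..}" and ?N = "{..<-c}"
  have "joint_rejection_prob c \<rho>
    = prob ((?P \<times> ?P \<union> ?N \<times> ?N) \<union> (?P \<times> ?N \<union> ?N \<times> ?P))"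
    unfolding joint_rejection_prob_def rejection_std_bivariate_normal
    by (intro arg_cong[where f=prob]) auto
  \<comment> \<open>Since \<open>c \<ge> 0\<close>, \<open>?P\<close> and \<open>?N\<close> are
    disjoint, and so are the four corners.\<close>
  also have "\<dots> = (prob (?P \<times> ?P) + prob (?N \<times> ?N)) + (prob (?P \<times> ?N) + prob (?N \<times> ?P))"
  proof -
    have "prob (?P \<times> ?P \<union> ?N \<times> ?N) = prob (?P \<times> ?P) + prob (?N \<times> ?N)"
      "prob (?P \<times> ?N \<union> ?N \<times> ?P) = prob (?P \<times> ?N) + prob (?N \<times> ?P)"
      using c by (intro finite_measure_Union; auto)+
    then show ?thesis
      using c by (subst finite_measure_Union) auto
  qed
  also have "prob (?N \<times> ?N) = prob (?P \<times> ?P)"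
    using \<rho> by (subst measure_std_bivariate_normal_linear[of \<rho> \<rho> "-1" 0 0 "-1"])
      (auto intro!: arg_cong[where f=prob])
  also have "prob (?P \<times> ?N) = measure (std_bivariate_normal (- \<rho>)) (?P \<times> ?P)"
    using \<rho> by (subst measure_std_bivariate_normal_linear[of \<rho> "- \<rho>" 1 0 0 "-1"])
      (auto intro!: arg_cong[where f=prob])
  also have "prob (?N \<times> ?P) = measure (std_bivariate_normal (- \<rho>)) (?P \<times> ?P)"
    using \<rho> by (subst measure_std_bivariate_normal_linear[of \<rho> "- \<rho>" "-1" 0 0 1])
      (auto intro!: arg_cong[where f=prob])
  finally show ?thesis
    using upper[OF \<rho>] upper[of "- \<rho>"] \<rho> by simp
qed

text \<open>Tonelli in the triangular representation: for \<open>x\<close> between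
  \<open>- c\<close> and \<open>c\<close> the section of the preimage is the interval from
  \<open>(- c - \<rho> * x) / s\<close> to \<open>(c - \<rho> * x) / s\<close>, and for other
  \<open>x\<close> it is empty.\<close>

lemma measure_std_bivariate_normal_square:
  assumes \<rho>: "\<bar>\<rho>\<bar> < 1" and c: "0 \<le> c"
  shows "measure (std_bivariate_normal \<rho>) ({-c..c} \<times> {-c..c})
    = std_normal_strip_prob c c \<rho> - std_normal_strip_prob c (- c) \<rho>"
proof -
  interpret N: real_distribution std_normal_distribution by (rule real_dist_normal_dist)
  define s where "s = sqrt (1 - \<rho>\<^sup>2)"
  have s: "0 < s" using \<rho> by (simp add: s_def abs_square_less_1)
  let ?h = "\<lambda>x. std_normal_cdf ((c - \<rho> * x) / s) - std_normal_cdf ((- c - \<rho> * x) / s)"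
  let ?A = "{z. (fst z, \<rho> * fst z + s * snd z) \<in> {-c..c} \<times> {-c..c}}"
  have A: "?A \<in> sets std_normal_pair"
    unfolding sets_std_normal_pair
    by (intro borel_closed, simp add: mem_Times_iff)
      (intro closed_Collect_conj closed_Collect_le continuous_intros)
  have sec: "emeasure std_normal_distribution (Pair x -` ?A) = ennreal (indicator {-c..c} x * ?h x)" for x
  proof (cases "x \<in> {-c..c}")
    case True
    then have "Pair x -` ?A = {(- c - \<rho> * x) / s .. (c - \<rho> * x) / s}"
      using s by (auto simp: field_simps)
    then show ?thesis
      using True s c std_normal_cdf_diff(2)[of "(- c - \<rho> * x) / s" "(c - \<rho> * x) / s"]
      by (simp add: N.emeasure_eq_measure divide_right_mono)
  qed auto
  have mono: "0 \<le> ?h x" for x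
    using s c by (auto intro!: N.cdf_nondecreasing divide_right_mono)
  have cont: "continuous_on {-c..c} (\<lambda>x. std_normal_density x * ?h x)"
    using s by (intro continuous_intros continuous_on_std_normal_density) auto
  have [measurable]: "?h \<in> borel_measurable borel"
    using s by (intro borel_measurable_continuous_onI continuous_intros) auto
  have "emeasure (std_bivariate_normal \<rho>) ({-c..c} \<times> {-c..c}) = emeasure std_normal_pair ?A"
    unfolding std_bivariate_normal_eq_distr_canonical[OF \<rho>]
    by (subst emeasure_distr)
      (auto simp: measurable_cong_sets[OF sets_std_normal_pair refl] space_pair_measure s_def
        intro!: arg_cong[where f="emeasure _"] borel_measurable_continuous_onI continuous_intros)
  also have "\<dots> = (\<integral>\<^sup>+x. ennreal (indicator {-c..c} x * ?h x) \<partial>std_normal_distribution)"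
    by (simp only: N.emeasure_pair_measure_alt[OF A] sec)
  also have "\<dots> = (\<integral>\<^sup>+x. ennreal (std_normal_density x * ?h x) * indicator {-c..c} x \<partial>lborel)"
    using mono by (subst nn_integral_density)
      (auto intro!: nn_integral_cong simp: ennreal_mult'[symmetric] indicator_def)
  also have "\<dots> = ennreal (integral {-c..c} (\<lambda>x. std_normal_density x * ?h x))"
    using mono by (intro nn_integral_has_integral_lebesgue' integrable_integral integrable_continuous_interval cont) auto
  also have "integral {-c..c} (\<lambda>x. std_normal_density x * ?h x)
    = std_normal_strip_prob c c \<rho> - std_normal_strip_prob c (- c) \<rho>"
    unfolding std_normal_strip_prob_def s_def[symmetric] right_diff_distrib using s
    by (intro integral_diff integrable_continuous_interval continuous_intros
        continuous_on_std_normal_density) auto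
  finally have e: "emeasure (std_bivariate_normal \<rho>) ({-c..c} \<times> {-c..c})
    = ennreal (std_normal_strip_prob c c \<rho> - std_normal_strip_prob c (- c) \<rho>)" .
  \<comment> \<open>Without the sign, \<open>ennreal\<close> could have truncated a negative value
    to 0.\<close>
  have "0 \<le> std_normal_strip_prob c c \<rho> - std_normal_strip_prob c (- c) \<rho>"
    unfolding \<open>integral {-c..c} (\<lambda>x. std_normal_density x * ?h x) = _\<close>[symmetric]
    using mono by (intro integral_nonneg integrable_continuous_interval cont) auto
  then show ?thesis
    using e by (simp add: measure_def)
qed

text \<open>Joint rejection is the complement of a union of two strips, each of probability
  \<open>2 * std_normal_cdf c - 1\<close> whatever \<rho> is. By inclusion-exclusion only their
  intersection, the square, carries \<rho>.\<close>

lemma joint_rejection_prob_eq_strip: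
  assumes \<rho>: "\<bar>\<rho>\<bar> < 1" and c: "0 \<le> c"
  shows "joint_rejection_prob c \<rho> = 3 - 4 * std_normal_cdf c
    + (std_normal_strip_prob c c \<rho> - std_normal_strip_prob c (- c) \<rho>)"
proof -
  interpret prob_space "std_bivariate_normal \<rho>"
    by (rule prob_space_std_bivariate_normal[OF \<rho>])
  let ?X = "{-c..c} \<times> UNIV" and ?Y = "UNIV \<times> {-c..c}"
  have "joint_rejection_prob c \<rho> = prob (UNIV - (?X \<union> ?Y))"
    unfolding joint_rejection_prob_def rejection_std_bivariate_normal
    by (intro arg_cong[where f=prob]) auto
  also have "\<dots> = 1 - prob (?X \<union> ?Y)"
    using prob_compl[of "?X \<union> ?Y"] by (simp add: sets.Un)
  also have "prob (?X \<union> ?Y) = prob ?X + prob ?Y - prob (?X \<inter> ?Y)"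
    by (rule measure_Un3) (auto simp: fmeasurable_eq_sets)
  also have "?X \<inter> ?Y = {-c..c} \<times> {-c..c}" by auto
  finally show ?thesis
    using std_normal_cdf_diff(2)[of "-c" c] c \<rho>
    by (simp add: measure_std_bivariate_normal_fst measure_std_bivariate_normal_snd
        measure_std_bivariate_normal_square std_normal_cdf_minus)
qed

lemma joint_rejection_prob_strict_mono:
  assumes "0 < c" "0 \<le> \<rho>" "\<rho> < \<rho>'" "\<rho>' < 1"
  shows "joint_rejection_prob c \<rho> < joint_rejection_prob c \<rho>'"
  using std_normal_strip_prob_diff_strict_mono[OF assms] assms
  by (simp add: joint_rejection_prob_eq_strip)

text \<open>At correlation 0 the CDF factor in the strip integral no longer depends on
  \<open>x\<close> and comes out: this is independence. For the critical value the result is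
  \<open>\<alpha>\<^sup>2\<close>.\<close>

lemma joint_rejection_prob_0:
  assumes "0 \<le> c"
  shows "joint_rejection_prob c 0 = (2 - 2 * std_normal_cdf c)\<^sup>2"
proof -
  have *: "std_normal_strip_prob c a 0 = (2 * std_normal_cdf c - 1) * std_normal_cdf a" for a
    using assms std_normal_cdf_diff(1)[of "-c" c]
    by (simp add: std_normal_strip_prob_def std_normal_cdf_minus)
  show ?thesis
    using assms by (simp add: joint_rejection_prob_eq_strip * std_normal_cdf_minus power2_eq_square
        algebra_simps)
qed

section \<open>Transfer to arbitrary jointly normal test statistics\<close>

lemma (in prob_space) covariance_indicator:
  assumes [measurable]: "A \<in> events" "B \<in> events"
  shows "covariance M (indicator A) (indicator B) = prob (A \<inter> B) - prob A * prob B"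
proof -
  have "covariance M (indicator A) (indicator B)
    = expectation (\<lambda>x. indicator (A \<inter> B) x - prob B * indicator A x - prob A * indicator B x + prob A * prob B)"
    unfolding covariance_def by (simp add: algebra_simps indicator_inter_arith)
  also have "\<dots> = prob (A \<inter> B) - prob A * prob B"
    using assms by (simp add: prob_space emeasure_eq_measure)
  finally show ?thesis .
qed

text \<open>The first moments force the shifts to be 0, and the second moments force unit rows with
  inner product \<rho>; all matrices of this kind give the same law.\<close>

lemma jointly_normal_standardized_distr:
  assumes "prob_space M" and jn: "jointly_normal M X Y"
    and X: "prob_space.expectation M X = 0" "prob_space.variance M X = 1"
    and Y: "prob_space.expectation M Y = 0" "prob_space.variance M Y = 1"
    and \<rho>: "correlation M X Y = \<rho>" "\<bar>\<rho>\<bar> < 1"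
  shows "distr M borel (\<lambda>\<omega>. (X \<omega>, Y \<omega>)) = std_bivariate_normal \<rho>"
proof -
  interpret prob_space M by fact
  have [measurable]: "X \<in> borel_measurable M" "Y \<in> borel_measurable M"
    using jn by (auto simp: jointly_normal_def)
  obtain m1 m2 a b c d where eq: "distr M borel (\<lambda>\<omega>. (X \<omega>, Y \<omega>)) = distr std_normal_pair borel
      (\<lambda>z. (m1 + a * fst z + b * snd z, m2 + c * fst z + d * snd z))"
    using jn unfolding jointly_normal_def case_prod_beta by blast
  have transfer: "expectation (\<lambda>\<omega>. f (X \<omega>, Y \<omega>))
    = (\<integral>z. f (m1 + a * fst z + b * snd z, m2 + c * fst z + d * snd z) \<partial>std_normal_pair)"
    if f: "f \<in> borel_measurable borel" for f :: "real \<times> real \<Rightarrow> real"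
  proof -
    have "expectation (\<lambda>\<omega>. f (X \<omega>, Y \<omega>)) = integral\<^sup>L (distr M borel (\<lambda>\<omega>. (X \<omega>, Y \<omega>))) f"
      by (rule integral_distr[symmetric, OF _ f]) measurable
    also have "\<dots> = (\<integral>z. f (m1 + a * fst z + b * snd z, m2 + c * fst z + d * snd z) \<partial>std_normal_pair)"
      unfolding eq by (rule integral_distr[OF _ f])
        (auto simp: measurable_cong_sets[OF sets_std_normal_pair refl]
          intro!: borel_measurable_continuous_onI continuous_intros)
    finally show ?thesis .
  qed
  have m: "m1 = 0" "m2 = 0"
    using transfer[OF borel_measurable_fst_snd(1)] transfer[OF borel_measurable_fst_snd(2)] X Y
    by (simp_all add: integral_std_normal_pair_affine)
  \<comment> \<open>With zero means and unit variances the correlation is just the expectation of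
    the product.\<close>
  have "a\<^sup>2 + b\<^sup>2 = 1" "c\<^sup>2 + d\<^sup>2 = 1" "a * c + b * d = \<rho>"
    using transfer[of "\<lambda>z. fst z * fst z"] transfer[of "\<lambda>z. snd z * snd z"]
      transfer[of "\<lambda>z. fst z * snd z"] X Y \<rho>
    by (simp_all add: m integral_std_normal_pair_bilinear power2_eq_square correlation_def covariance_def)
  from std_bivariate_normal_eq_distr[OF this \<rho>(2)] show ?thesis
    by (simp add: eq m)
qed

theorem proposition1:
  fixes \<alpha> c \<rho> :: real
    and M :: "'a measure"
    and Ti Tj :: "'a \<Rightarrow> real"
  assumes "\<alpha> \<in> {0<..<1}"
    and "std_normal_cdf c = 1 - \<alpha> / 2"
    and "\<rho> \<in> {-1<..<1}"
    and "prob_space M"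
    and "jointly_normal M Ti Tj"
    and "prob_space.expectation M Ti = 0" and "prob_space.expectation M Tj = 0"
    and "prob_space.variance M Ti = 1" and "prob_space.variance M Tj = 1"
    and "correlation M Ti Tj = \<rho>"
  shows
    "(measure M (rejection M Ti c \<inter> rejection M Tj c)
        = 4 - 8 * std_normal_cdf c
          + 2 * std_bivariate_normal_cdf \<rho> c c + 2 * std_bivariate_normal_cdf (- \<rho>) c c
      \<and> measure M (rejection M Ti c \<inter> rejection M Tj c)
        = \<alpha>\<^sup>2 + 2 * (std_bivariate_normal_cdf \<rho> c c + std_bivariate_normal_cdf (- \<rho>) c c
                   - 2 * (std_normal_cdf c)\<^sup>2))
     \<and> (measure M (rejection M Ti c \<inter> rejection M Tj c) = joint_rejection_prob c \<rho>
        \<and> strict_mono_on {0<..<1} (joint_rejection_prob c))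
     \<and> (\<rho> > 0 \<longrightarrow>
          covariance M (indicator (rejection M Ti c)) (indicator (rejection M Tj c)) > 0)"
proof -
  interpret prob_space M by fact
  have c: "0 < c"
    using assms(1,2) by (intro std_normal_cdf_gt_half_imp_pos) auto
  have \<rho>: "\<bar>\<rho>\<bar> < 1" using assms(3) by auto
  have \<alpha>: "\<alpha> = 2 - 2 * std_normal_cdf c" using assms(2) by simp
  have [measurable]: "Ti \<in> borel_measurable M" "Tj \<in> borel_measurable M"
    using assms(5) by (auto simp: jointly_normal_def)
  have law: "distr M borel (\<lambda>\<omega>. (Ti \<omega>, Tj \<omega>)) = std_bivariate_normal \<rho>"
    using assms \<rho> by (intro jointly_normal_standardized_distr) auto
  \<comment> \<open>Stated for rectangles so that a factor \<open>UNIV\<close> also yields the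
    marginal rejection probabilities.\<close>
  have transfer: "prob {\<omega> \<in> space M. (Ti \<omega>, Tj \<omega>) \<in> A \<times> C}
      = measure (std_bivariate_normal \<rho>) (A \<times> C)"
    if "A \<in> sets borel" "C \<in> sets borel" for A C
    unfolding law[symmetric] using that
    by (subst measure_distr)
      (auto simp: borel_prod[symmetric] intro!: arg_cong[where f=prob])
  let ?R = "{x. c < \<bar>x\<bar>}"
  have R: "?R \<in> sets borel" by measurable
  have joint: "prob (rejection M Ti c \<inter> rejection M Tj c) = joint_rejection_prob c \<rho>"
  proof -
    have "rejection M Ti c \<inter> rejection M Tj c = {\<omega> \<in> space M. (Ti \<omega>, Tj \<omega>) \<in> ?R \<times> ?R}"
      by (auto simp: rejection_def)
    moreover have "{z. c < \<bar>fst z\<bar>} \<inter> {z. c < \<bar>snd z\<bar>} = ?R \<times> ?R" by auto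
    ultimately show ?thesis
      unfolding joint_rejection_prob_def rejection_std_bivariate_normal
      using transfer[OF R R] by simp
  qed
  have "measure std_normal_distribution ?R = \<alpha>"
  proof -
    interpret N: real_distribution std_normal_distribution by (rule real_dist_normal_dist)
    have "?R = UNIV - {-c..c}" by auto
    then show ?thesis
      using N.prob_compl[of "{-c..c}"] std_normal_cdf_diff(2)[of "-c" c] c
      by (simp add: \<alpha> std_normal_cdf_minus)
  qed
  then have marg: "prob (rejection M Ti c) = \<alpha>" "prob (rejection M Tj c) = \<alpha>"
    using transfer[of ?R UNIV] transfer[of UNIV ?R] R \<rho>
    by (simp_all add: rejection_def measure_std_bivariate_normal_fst measure_std_bivariate_normal_snd)
  have cov: "covariance M (indicator (rejection M Ti c)) (indicator (rejection M Tj c))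
    = joint_rejection_prob c \<rho> - \<alpha>\<^sup>2"
    by (subst covariance_indicator) (simp_all add: joint marg power2_eq_square, simp_all add: rejection_def)
  \<comment> \<open>Strict growth starting from correlation 0, where the value is
    \<open>\<alpha>\<^sup>2\<close>, the product of the two marginal probabilities.\<close>
  have "\<rho> > 0 \<Longrightarrow> \<alpha>\<^sup>2 < joint_rejection_prob c \<rho>"
    using joint_rejection_prob_strict_mono[of c 0 \<rho>] joint_rejection_prob_0[of c] c \<rho>
    by (simp add: \<alpha>)
  moreover have "strict_mono_on {0<..<1} (joint_rejection_prob c)"
    using c by (auto intro!: strict_mono_onI joint_rejection_prob_strict_mono)
  \<comment> \<open>With \<open>\<alpha> = 2 - 2 * std_normal_cdf c\<close>, the constant
    \<open>4 - 8 * std_normal_cdf c\<close> equals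
    \<open>\<alpha>\<^sup>2 - 4 * (std_normal_cdf c)\<^sup>2\<close>.\<close>
  moreover have "joint_rejection_prob c \<rho> = \<alpha>\<^sup>2 + 2 * (std_bivariate_normal_cdf \<rho> c c
      + std_bivariate_normal_cdf (- \<rho>) c c - 2 * (std_normal_cdf c)\<^sup>2)"
    using c \<rho> by (simp add: joint_rejection_prob_eq_cdf \<alpha> power2_eq_square algebra_simps)
  ultimately show ?thesis
    using c \<rho> by (simp add: joint cov joint_rejection_prob_eq_cdf)
qed

end
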